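(* If $\mathcal{P}$ is a family of $d$-dimensional 0-1 matrices with $k$ members for some $k < d$, then (for every positive integer $n$) either $\operatorname{ex}(n, \mathcal{P}, d) = 0$ or $\operatorname{ex}(n, \mathcal{P}, d) \ge n^{d-k}$.
   Context: A $d$-dimensional 0-1 matrix $A$ contains a $d$-dimensional 0-1 matrix $P$ if $A$ has a submatrix (obtained by restricting each of the $d$ coordinates to a subset of its range) of the same dimensions as $P$ that can be turned into $P$ by changing any number of $1$-entries to $0$-entries; otherwise $A$ avoids $P$. For a family $\mathcal{P}$ of $d$-dimensional 0-1 matrices, $\operatorname{ex}(n,\mathcal{P},d)$ is the maximum possible number of $1$-entries in a $d$-dimensional $n\times\dots\times n$ 0-1 matrix that avoids every element of $\mathcal{P}$; it is taken to be $0$ if no such matrix exists (e.g. when $\mathcal{P}$ contains an all-zeros pattern that fits in the $n\times\dots\times n$ matrix). *)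

theory Defs
  imports Main
begin

text \<open>
  A 0-1 matrix is given by its list of side lengths together with the set of positions of its
  1-entries. Positions are lists of coordinates, counted from 0. The two components determine
  the matrix, so equality of records is equality of matrices.
\<close>

record zo_matrix =
  sides :: "nat list"
  ones :: "nat list set"

definition positions :: "nat list \<Rightarrow> nat list set" where
  "positions ns = {x. list_all2 (<) x ns}"

definition is_zo_matrix :: "nat \<Rightarrow> zo_matrix \<Rightarrow> bool" where
  "is_zo_matrix d A \<longleftrightarrow>
     length (sides A) = d \<and> (\<forall>m \<in> set (sides A). 0 < m) \<and> ones A \<subseteq> positions (sides A)"

text \<open>
  The submatrix obtained by restricting the \<open>i\<close>-th coordinate to the finite set \<open>Ss ! i\<close>, for
  every \<open>i\<close>: coordinate value \<open>j\<close> of the submatrix refers to the \<open>j\<close>-th smallest element of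
  that set.
\<close>

definition submatrix :: "zo_matrix \<Rightarrow> nat set list \<Rightarrow> zo_matrix" where
  "submatrix A Ss =
     \<lparr>sides = map card Ss,
      ones = {x \<in> positions (map card Ss). map2 (\<lambda>S j. sorted_list_of_set S ! j) Ss x \<in> ones A}\<rparr>"

definition contains :: "zo_matrix \<Rightarrow> zo_matrix \<Rightarrow> bool" where
  "contains A P \<longleftrightarrow>
     (\<exists>Ss. list_all2 (\<lambda>S m. S \<subseteq> {..<m}) Ss (sides A) \<and>
           sides (submatrix A Ss) = sides P \<and> ones P \<subseteq> ones (submatrix A Ss))"

definition avoids :: "zo_matrix \<Rightarrow> zo_matrix \<Rightarrow> bool" where
  "avoids A P \<longleftrightarrow> \<not> contains A P"

definition avoiders :: "nat \<Rightarrow> zo_matrix set \<Rightarrow> nat \<Rightarrow> zo_matrix set" where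
  "avoiders n Ps d =
     {A. is_zo_matrix d A \<and> sides A = replicate d n \<and> (\<forall>P \<in> Ps. avoids A P)}"

definition ex_number :: "nat \<Rightarrow> zo_matrix set \<Rightarrow> nat \<Rightarrow> nat" where
  "ex_number n Ps d =
     (if avoiders n Ps d = {} then 0 else Max ((\<lambda>A. card (ones A)) ` avoiders n Ps d))"

end

theory Submission
  imports Defs
begin

text \<open>
  Let \<open>A\<close> be an avoider with a 1-entry \<open>p\<close>. For every \<open>P\<close> in the family there is a coordinate
  \<open>i\<close> such that even the matrix whose 1-entries fill the hyperplane \<open>x\<^sub>i = p\<^sub>i\<close> avoids \<open>P\<close>:
  otherwise take, for each \<open>i\<close>, the \<open>i\<close>-th index set of a copy of \<open>P\<close> in that hyperplane; the
  combined index sets send every 1-entry of \<open>P\<close> to \<open>p\<close>, so \<open>A\<close> would contain \<open>P\<close>. Intersecting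
  one such hyperplane for each of the \<open>k\<close> members leaves at least \<open>n\<^bsup>d-k\<^esup>\<close> 1-entries.
\<close>

lemma mem_positions_iff:
  "x \<in> positions ns \<longleftrightarrow> length x = length ns \<and> (\<forall>i < length ns. x ! i < ns ! i)"
  by (auto simp: positions_def list_all2_conv_all_nth)

text \<open>Both \<open>positions\<close> and the 1-entries of a \<open>slice\<close> are products
  of finite sets, with tuples encoded as lists; this serves finiteness of the former and the count
  of the latter.\<close>

lemma
  assumes "\<forall>A \<in> set As. finite A"
  shows finite_list_all2_mem: "finite {xs. list_all2 (\<in>) xs As}"
    and card_list_all2_mem: "card {xs. list_all2 (\<in>) xs As} = prod_list (map card As)"
proof -
  have "finite {xs. list_all2 (\<in>) xs As} \<and>
      card {xs. list_all2 (\<in>) xs As} = prod_list (map card As)"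
    using assms
  proof (induction As)
    case Nil
    then show ?case by simp
  next
    case (Cons A As)
    have "{xs. list_all2 (\<in>) xs (A # As)} =
        (\<lambda>(x, xs). x # xs) ` (A \<times> {xs. list_all2 (\<in>) xs As})"
      by (auto simp: list_all2_Cons2)
    moreover have "inj_on (\<lambda>(x, xs). x # xs) (A \<times> {xs. list_all2 (\<in>) xs As})"
      by (auto simp: inj_on_def)
    ultimately show ?case
      using Cons by (simp add: card_image card_cartesian_product)
  qed
  then show "finite {xs. list_all2 (\<in>) xs As}"
    "card {xs. list_all2 (\<in>) xs As} = prod_list (map card As)"
    by auto
qed

lemma finite_positions: "finite (positions ns)"
proof -
  have "positions ns = {xs. list_all2 (\<in>) xs (map lessThan ns)}"
    by (auto simp: mem_positions_iff list_all2_conv_all_nth)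
  then show ?thesis
    by (simp add: finite_list_all2_mem)
qed

lemma contains_mono:
  assumes "contains A P" and "sides A = sides B" and "ones A \<subseteq> ones B"
  shows "contains B P"
  using assms unfolding contains_def submatrix_def by fastforce

text \<open>The axis-parallel flat through \<open>p\<close> with the coordinates in \<open>I\<close>
  frozen. Taking a set \<open>I\<close> covers single hyperplanes and their intersections
  alike.\<close>

definition slice :: "nat list \<Rightarrow> nat list \<Rightarrow> nat set \<Rightarrow> zo_matrix" where
  "slice ns p I = \<lparr>sides = ns, ones = {x \<in> positions ns. \<forall>i \<in> I. x ! i = p ! i}\<rparr>"

text \<open>Coordinate \<open>i\<close> of an embedded position depends only on the
  \<open>i\<close>-th index set, so copies of \<open>P\<close> found in different hyperplanes can be
  mixed coordinate by coordinate.\<close>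

lemma contains_if_all_hyperplanes_contain:
  assumes "p \<in> ones A" and "length p = length (sides A)"
    and hyp: "\<And>i. i < length (sides A) \<Longrightarrow> contains (slice (sides A) p {i}) P"
    and "is_zo_matrix (length (sides A)) P"
  shows "contains A P"
proof -
  define d where "d = length (sides A)"
  have "\<exists>Ss. list_all2 (\<lambda>S m. S \<subseteq> {..<m}) Ss (sides A) \<and> map card Ss = sides P \<and>
      (\<forall>x \<in> ones P. map2 (\<lambda>S j. sorted_list_of_set S ! j) Ss x ! i = p ! i)" if "i < d" for i
    using hyp[of i] that unfolding contains_def submatrix_def slice_def d_def by fastforce
  then obtain Ss where Ss: "\<And>i. i < d \<Longrightarrow> list_all2 (\<lambda>S m. S \<subseteq> {..<m}) (Ss i) (sides A)"
    "\<And>i. i < d \<Longrightarrow> map card (Ss i) = sides P"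
    "\<And>i x. i < d \<Longrightarrow> x \<in> ones P \<Longrightarrow>
      map2 (\<lambda>S j. sorted_list_of_set S ! j) (Ss i) x ! i = p ! i"
    by metis
  have len: "length (Ss i) = d" if "i < d" for i
    using Ss(1)[OF that] by (auto simp: d_def list_all2_lengthD)
  have P: "length (sides P) = d" "ones P \<subseteq> positions (sides P)"
    using assms(4) by (auto simp: is_zo_matrix_def d_def)
  \<comment> \<open>Diagonal choice: copy \<open>i\<close> contributes only its \<open>i\<close>-th
    index set. That set has size \<open>sides P ! i\<close>, so \<open>T\<close> still has the shape
    of \<open>P\<close>.\<close>
  define T where "T = map (\<lambda>i. Ss i ! i) [0..<d]"
  have T1: "list_all2 (\<lambda>S m. S \<subseteq> {..<m}) T (sides A)"
    using Ss(1) by (simp add: T_def list_all2_conv_all_nth d_def)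
  have T2: "map card T = sides P"
  proof (rule nth_equalityI)
    fix i assume "i < length (map card T)"
    then have "i < d" by (simp add: T_def)
    then show "map card T ! i = sides P ! i"
      using arg_cong[OF Ss(2), of i "\<lambda>xs. xs ! i"] len by (simp add: T_def)
  qed (simp add: T_def P)
  have T3: "map2 (\<lambda>S j. sorted_list_of_set S ! j) T x = p" if "x \<in> ones P" for x
  proof (rule nth_equalityI)
    have lx: "length x = d"
      using that P by (auto simp: mem_positions_iff)
    then show "length (map2 (\<lambda>S j. sorted_list_of_set S ! j) T x) = length p"
      using assms(2) by (simp add: T_def d_def)
    fix i assume "i < length (map2 (\<lambda>S j. sorted_list_of_set S ! j) T x)"
    then have "i < d" by (simp add: T_def)
    then show "map2 (\<lambda>S j. sorted_list_of_set S ! j) T x ! i = p ! i"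
      using Ss(3)[OF _ that, of i] len lx by (simp add: T_def)
  qed
  show ?thesis
    unfolding contains_def submatrix_def using T1 T2 T3 P assms(1) by (intro exI[of _ T]) auto
qed

lemma card_ones_slice:
  assumes "p \<in> positions (replicate d n)" and "I \<subseteq> {..<d}"
  shows "card (ones (slice (replicate d n) p I)) = n ^ (d - card I)"
proof -
  \<comment> \<open>The slice as a product: a singleton for each frozen coordinate, the full range
    for each free one. Each singleton lies in range because \<open>p\<close> is a position.\<close>
  define As where "As = map (\<lambda>i. if i \<in> I then {p ! i} else {..<n}) [0..<d]"
  have "ones (slice (replicate d n) p I) = {xs. list_all2 (\<in>) xs As}"
    using assms
    by (auto simp: slice_def As_def mem_positions_iff list_all2_conv_all_nth split: if_splits)
  then have "card (ones (slice (replicate d n) p I)) = prod_list (map card As)"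
    using card_list_all2_mem[of As] by (auto simp: As_def)
  also have "\<dots> = (\<Prod>i<d. if i \<in> I then 1 else n)"
    by (simp add: As_def prod.list_conv_set_nth atLeast0LessThan if_distrib cong: if_cong)
  also have "\<dots> = n ^ card ({..<d} - I)"
    by (simp add: prod.If_cases Diff_eq)
  also have "card ({..<d} - I) = d - card I"
    using assms(2) by (simp add: card_Diff_subset finite_subset)
  finally show ?thesis .
qed

lemma finite_card_ones_avoiders: "finite ((\<lambda>A. card (ones A)) ` avoiders n Ps d)"
proof -
  have "(\<lambda>A. card (ones A)) ` avoiders n Ps d \<subseteq> {..card (positions (replicate d n))}"
    by (auto simp: avoiders_def is_zo_matrix_def intro!: card_mono finite_positions)
  then show ?thesis
    using finite_subset by blast
qed

lemma card_ones_le_ex_number: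
  assumes "A \<in> avoiders n Ps d"
  shows "card (ones A) \<le> ex_number n Ps d"
  using assms finite_card_ones_avoiders by (auto simp: ex_number_def intro: Max_ge)

lemma ex_number_attained:
  assumes "ex_number n Ps d \<noteq> 0"
  obtains A where "A \<in> avoiders n Ps d" and "card (ones A) = ex_number n Ps d"
proof -
  \<comment> \<open>A nonzero value cannot be the default for an empty set of avoiders, so it is a
    true maximum.\<close>
  have ne: "avoiders n Ps d \<noteq> {}"
    using assms by (auto simp: ex_number_def)
  then have "ex_number n Ps d \<in> (\<lambda>A. card (ones A)) ` avoiders n Ps d"
    using Max_in[OF finite_card_ones_avoiders] by (simp add: ex_number_def)
  then show ?thesis
    using that by auto
qed

theorem proposition3p25:
  fixes d k n :: nat and Ps :: "zo_matrix set"
  assumes "\<forall>P \<in> Ps. is_zo_matrix d P"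
    and "finite Ps" and "card Ps = k" and "k < d"
    and "n > 0"
  shows "ex_number n Ps d = 0 \<or> ex_number n Ps d \<ge> n ^ (d - k)"
proof (cases "ex_number n Ps d = 0")
  case False
  then obtain A where A: "A \<in> avoiders n Ps d" and "card (ones A) \<noteq> 0"
    by (metis ex_number_attained)
  then obtain p where p: "p \<in> ones A"
    by fastforce
  have sA: "sides A = replicate d n" and pp: "p \<in> positions (replicate d n)"
    using A p by (auto simp: avoiders_def is_zo_matrix_def)
  then have "length p = d"
    by (simp add: mem_positions_iff)
  then have "\<exists>i<d. avoids (slice (replicate d n) p {i}) P" if "P \<in> Ps" for P
    using contains_if_all_hyperplanes_contain[OF p, of P] that A assms(1) sA
    by (auto simp: avoids_def avoiders_def)
  then obtain c where c: "\<And>P. P \<in> Ps \<Longrightarrow> c P < d"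
    "\<And>P. P \<in> Ps \<Longrightarrow> avoids (slice (replicate d n) p {c P}) P"
    by metis
  define B where "B = slice (replicate d n) p (c ` Ps)"
  \<comment> \<open>The 1-entries of \<open>B\<close> lie in the hyperplane chosen for
    \<open>P\<close>, and removing 1-entries preserves avoidance.\<close>
  have "avoids B P" if "P \<in> Ps" for P
    using c(2)[OF that] that contains_mono[of B P "slice (replicate d n) p {c P}"]
    by (auto simp: avoids_def B_def slice_def)
  then have "B \<in> avoiders n Ps d"
    using assms(5) by (auto simp: avoiders_def B_def slice_def is_zo_matrix_def)
  then have "card (ones B) \<le> ex_number n Ps d"
    by (rule card_ones_le_ex_number)
  moreover have "card (ones B) = n ^ (d - card (c ` Ps))"
    unfolding B_def using c(1) by (intro card_ones_slice pp) auto
  \<comment> \<open>Several patterns may share a coordinate, so at most \<open>k\<close> coordinates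
    are frozen; monotonicity of the power uses \<open>n > 0\<close>.\<close>
  moreover have "n ^ (d - k) \<le> n ^ (d - card (c ` Ps))"
    using assms card_image_le[of Ps c] by (intro power_increasing diff_le_mono2) auto
  ultimately show ?thesis
    by simp
qed simp

end
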